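(* Let $S=\{C_1,\dots,C_n\}$ be a finite set of propositional clauses containing no tautologies and no pure literal clauses. If $S$ is unsatisfiable, then there exists a deduction sequence of contradiction separation based on standard extension from $S$ to the empty clause $\emptyset$.
   Context: Propositional logic. A literal is a propositional variable or its negation; $p$ and $\neg p$ are complementary. A clause is a finite disjunction of literals, identified with the finite set of its literals; $\emptyset$ is the empty clause. A tautology is a clause containing a complementary pair. A pure literal clause is a clause containing a literal whose complement occurs in no clause of $S$. Contradiction separation based on standard extension: let $m\ge2$, let $D_1,\dots,D_m$ be clauses (repetitions allowed) and $x_1,\dots,x_{m-1}$ literals, and suppose sub-clauses $D_i^-\subseteq D_i$ are chosen with $D_1^-=\{x_1\}$, $D_i^-=\{x_i,\neg x_{i-1}\}\cup D^i$ for $2\le i\le m-1$, $D_m^-=\{\neg x_{m-1}\}\cup D^m$, where $D^2=\emptyset$ and $D^j\subseteq\{\neg x_1,\dots,\neg x_{j-2}\}$ for $3\le j\le m$. Put $D_i^+=D_i\setminus D_i^-$. Then $R_s(D_1,\dots,D_m)=\bigcup_{i=1}^m D_i^+$ is called a contradiction separation clause based on standard extension of $D_1,\dots,D_m$. A deduction sequence of contradiction separation based on standard extension from $S$ to $\phi_t$ is a finite sequence of clauses $\phi_1,\dots,\phi_t$ such that each $\phi_i$ either belongs to $S$, or there exist indices $r_1,\dots,r_{k_i}<i$ such that $\phi_i$ is a contradiction separation clause based on standard extension $R_s(\phi_{r_1},\dots,\phi_{r_{k_i}})$. *)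

theory Defs
  imports Main
begin

datatype 'a literal = Pos 'a | Neg 'a

fun complement :: "'a literal \<Rightarrow> 'a literal" where
  "complement (Pos p) = Neg p"
| "complement (Neg p) = Pos p"

text \<open>A clause is the set of its literals; the type does not enforce finiteness, so
  \<open>is_clause\<close> is stated explicitly where clauses are required.\<close>

type_synonym 'a clause = "'a literal set"

definition is_clause :: "'a clause \<Rightarrow> bool" where
  "is_clause C \<longleftrightarrow> finite C"

fun literal_true :: "('a \<Rightarrow> bool) \<Rightarrow> 'a literal \<Rightarrow> bool" where
  "literal_true v (Pos p) = v p"
| "literal_true v (Neg p) = (\<not> v p)"

definition clause_true :: "('a \<Rightarrow> bool) \<Rightarrow> 'a clause \<Rightarrow> bool" where
  "clause_true v C \<longleftrightarrow> (\<exists>l\<in>C. literal_true v l)"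

definition satisfiable :: "'a clause set \<Rightarrow> bool" where
  "satisfiable S \<longleftrightarrow> (\<exists>v. \<forall>C\<in>S. clause_true v C)"

definition tautology :: "'a clause \<Rightarrow> bool" where
  "tautology C \<longleftrightarrow> (\<exists>l\<in>C. complement l \<in> C)"

definition pure_literal_clause :: "'a clause set \<Rightarrow> 'a clause \<Rightarrow> bool" where
  "pure_literal_clause S C \<longleftrightarrow> (\<exists>l\<in>C. \<forall>C'\<in>S. complement l \<notin> C')"

text \<open>Finite sequences are functions on \<open>nat\<close> used only at the indices \<open>1, \<dots>, m\<close>.
  In \<open>standard_extension m D x Dm E\<close> the sub-clause \<open>D\<^sub>i\<^sup>-\<close> is \<open>Dm i\<close> and the set
  \<open>D\<^sup>i\<close> of additional negated literals is \<open>E i\<close>. The literals \<open>x\<^sub>i\<close> need not be distinct.\<close>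

definition standard_extension ::
  "nat \<Rightarrow> (nat \<Rightarrow> 'a clause) \<Rightarrow> (nat \<Rightarrow> 'a literal) \<Rightarrow> (nat \<Rightarrow> 'a clause) \<Rightarrow> (nat \<Rightarrow> 'a clause) \<Rightarrow> bool"
where
  "standard_extension m D x Dm E \<longleftrightarrow>
     m \<ge> 2 \<and>
     (\<forall>i\<in>{1..m}. is_clause (D i) \<and> Dm i \<subseteq> D i) \<and>
     Dm 1 = {x 1} \<and>
     (\<forall>i\<in>{2..m-1}. Dm i = {x i, complement (x (i-1))} \<union> E i) \<and>
     Dm m = {complement (x (m-1))} \<union> E m \<and>
     E 2 = {} \<and>
     (\<forall>j\<in>{3..m}. E j \<subseteq> {complement (x k) | k. k \<in> {1..j-2}})"

definition is_cs_clause :: "nat \<Rightarrow> (nat \<Rightarrow> 'a clause) \<Rightarrow> 'a clause \<Rightarrow> bool" where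
  "is_cs_clause m D R \<longleftrightarrow>
     (\<exists>x Dm E. standard_extension m D x Dm E \<and> R = (\<Union>i\<in>{1..m}. D i - Dm i))"

definition cs_deduction :: "'a clause set \<Rightarrow> nat \<Rightarrow> (nat \<Rightarrow> 'a clause) \<Rightarrow> bool" where
  "cs_deduction S t \<phi> \<longleftrightarrow>
     t \<ge> 1 \<and>
     (\<forall>i\<in>{1..t}. is_clause (\<phi> i) \<and>
        (\<phi> i \<in> S \<or>
         (\<exists>k r. (\<forall>j\<in>{1..k}. r j \<in> {1..<i}) \<and> is_cs_clause k (\<lambda>j. \<phi> (r j)) (\<phi> i))))"

end

theory Submission
  imports Defs
begin

text \<open>For \<open>m = 2\<close> a contradiction separation clause is a binary resolvent, so it suffices to
  prove refutational completeness of resolution. This is a semantic-tree argument: given a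
  valuation \<open>v\<close> and a finite set \<open>B\<close> of variables, induction on \<open>B\<close> yields a derived clause that is
  false under \<open>v\<close> and free of \<open>B\<close>; in the step, the clauses obtained for \<open>v(p := True)\<close> and
  \<open>v(p := False)\<close> are resolved on \<open>p\<close> unless one of them is already free of \<open>p\<close>. When \<open>B\<close>
  contains all variables of \<open>S\<close>, the derived clause is empty.\<close>

text \<open>Only the premises at indices \<open>1..m\<close> enter the definition. This permits
  changing or shifting a deduction outside the positions that an inference refers to.\<close>

lemma is_cs_clause_cong:
  assumes "\<And>i. i \<in> {1..m} \<Longrightarrow> D i = D' i"
  shows "is_cs_clause m D R \<longleftrightarrow> is_cs_clause m D' R"
proof -
  have "standard_extension m D x Dm E \<longleftrightarrow> standard_extension m D' x Dm E" for x Dm E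
    using assms unfolding standard_extension_def by auto
  moreover have "(\<Union>i\<in>{1..m}. D i - Dm i) = (\<Union>i\<in>{1..m}. D' i - Dm i)" for Dm
    using assms by auto
  ultimately show ?thesis
    unfolding is_cs_clause_def by simp
qed

lemma is_cs_clause_resolvent:
  assumes "is_clause (D 1)" "is_clause (D 2)" "x \<in> D 1" "complement x \<in> D 2"
  shows "is_cs_clause 2 D (D 1 - {x} \<union> (D 2 - {complement x}))"
proof -
  \<comment> \<open>For \<open>m = 2\<close> the range \<open>{2..m-1}\<close> is empty, so the only
    data are \<open>{x}\<close> and its complement, with all \<open>E i\<close> empty.\<close>
  let ?Dm = "\<lambda>i::nat. if i = 1 then {x} else {complement x}"
  have I: "{1..2} = {1, 2::nat}" by auto
  have "standard_extension 2 D (\<lambda>_. x) ?Dm (\<lambda>_. {})"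
    using assms unfolding standard_extension_def I by auto
  moreover have "D 1 - {x} \<union> (D 2 - {complement x}) = (\<Union>i\<in>{1..2}. D i - ?Dm i)"
    unfolding I by simp
  ultimately show ?thesis
    unfolding is_cs_clause_def by blast
qed

text \<open>Shifting the second deduction by \<open>t\<close> shifts its back-references by
  \<open>t\<close> too, so every inference survives and the last clauses of both deductions become
  available together.\<close>

lemma cs_deduction_append:
  assumes \<phi>: "cs_deduction S t \<phi>" and \<psi>: "cs_deduction S u \<psi>"
  shows "cs_deduction S (t + u) (\<lambda>i. if i \<le> t then \<phi> i else \<psi> (i - t))"
    (is "cs_deduction S _ ?\<chi>")
  unfolding cs_deduction_def
proof (intro conjI ballI)
  show "1 \<le> t + u" using \<phi> unfolding cs_deduction_def by simp
next
  fix i assume i: "i \<in> {1..t + u}"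
  then have "i \<le> t \<and> i \<in> {1..t} \<or> \<not> i \<le> t \<and> i - t \<in> {1..u}"
    by auto
  then show "is_clause (?\<chi> i)"
    using \<phi> \<psi> unfolding cs_deduction_def by metis
  show "?\<chi> i \<in> S \<or> (\<exists>k r. (\<forall>j\<in>{1..k}. r j \<in> {1..<i}) \<and> is_cs_clause k (\<lambda>j. ?\<chi> (r j)) (?\<chi> i))"
  proof (cases "i \<le> t")
    case True
    with i \<phi> consider "\<phi> i \<in> S"
      | k r where "\<forall>j\<in>{1..k}. r j \<in> {1..<i}" "is_cs_clause k (\<lambda>j. \<phi> (r j)) (\<phi> i)"
      unfolding cs_deduction_def by (meson atLeastAtMost_iff)
    then show ?thesis
    proof cases
      case (2 k r)
      have "is_cs_clause k (\<lambda>j. ?\<chi> (r j)) (\<phi> i)"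
        using 2 True by (subst is_cs_clause_cong[where D' = "\<lambda>j. \<phi> (r j)"]) force+
      with 2 True show ?thesis by auto
    qed (use True in simp)
  next
    case False
    with i have "i - t \<in> {1..u}" by auto
    with \<psi> consider "\<psi> (i - t) \<in> S"
      | k r where "\<forall>j\<in>{1..k}. r j \<in> {1..<i - t}" "is_cs_clause k (\<lambda>j. \<psi> (r j)) (\<psi> (i - t))"
      unfolding cs_deduction_def by meson
    then show ?thesis
    proof cases
      case (2 k r)
      \<comment> \<open>Since \<open>r j \<ge> 1\<close>, the index \<open>r j + t\<close> exceeds
        \<open>t\<close>, so \<open>?\<chi>\<close> takes its second branch there.\<close>
      have "is_cs_clause k (\<lambda>j. ?\<chi> (r j + t)) (\<psi> (i - t))"
        using 2 by (subst is_cs_clause_cong[where D' = "\<lambda>j. \<psi> (r j)"]) force+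
      moreover have "\<forall>j\<in>{1..k}. r j + t \<in> {1..<i}"
        using 2 by fastforce
      ultimately show ?thesis
        using False by (intro disjI2 exI[of _ k] exI[of _ "\<lambda>j. r j + t"]) simp
    qed (use False in simp)
  qed
qed

lemma cs_deduction_snoc:
  assumes \<phi>: "cs_deduction S t \<phi>" and R: "is_clause R"
    and r: "\<forall>j\<in>{1..k}. r j \<in> {1..t}" "is_cs_clause k (\<lambda>j. \<phi> (r j)) R"
  shows "cs_deduction S (Suc t) (\<phi>(Suc t := R))"
  unfolding cs_deduction_def
proof (intro conjI ballI)
  show "1 \<le> Suc t" by simp
next
  let ?\<chi> = "\<phi>(Suc t := R)"
  fix i assume i: "i \<in> {1..Suc t}"
  then show "is_clause (?\<chi> i)"
    using \<phi> R unfolding cs_deduction_def by simp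
  \<comment> \<open>References stay within \<open>1..t\<close>, so overwriting position
    \<open>Suc t\<close> does not affect them.\<close>
  have upd: "is_cs_clause k (\<lambda>j. ?\<chi> (r j)) C"
    if "is_cs_clause k (\<lambda>j. \<phi> (r j)) C" "\<forall>j\<in>{1..k}. r j \<in> {1..t}" for k r C
    using that by (subst is_cs_clause_cong[where D' = "\<lambda>j. \<phi> (r j)"]) force+
  show "?\<chi> i \<in> S \<or> (\<exists>k r. (\<forall>j\<in>{1..k}. r j \<in> {1..<i}) \<and> is_cs_clause k (\<lambda>j. ?\<chi> (r j)) (?\<chi> i))"
  proof (cases "i = Suc t")
    case True
    with upd[OF r(2,1)] r(1) show ?thesis
      by (intro disjI2 exI[of _ k] exI[of _ r]) (auto simp: less_Suc_eq_le)
  next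
    case False
    with i have it: "i \<in> {1..t}" by auto
    with \<phi> consider "\<phi> i \<in> S"
      | k r where "\<forall>j\<in>{1..k}. r j \<in> {1..<i}" "is_cs_clause k (\<lambda>j. \<phi> (r j)) (\<phi> i)"
      unfolding cs_deduction_def by meson
    then show ?thesis
    proof cases
      case (2 k r)
      then have "\<forall>j\<in>{1..k}. r j \<in> {1..t}" using it by fastforce
      from upd[OF 2(2) this] 2(1) False show ?thesis by auto
    qed (use False in simp)
  qed
qed

definition cs_deducible :: "'a clause set \<Rightarrow> 'a clause \<Rightarrow> bool" where
  "cs_deducible S C \<longleftrightarrow> (\<exists>t \<phi>. cs_deduction S t \<phi> \<and> \<phi> t = C)"

lemma cs_deducible_input:
  assumes "C \<in> S" "is_clause C"
  shows "cs_deducible S C"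
  unfolding cs_deducible_def
  by (rule exI[of _ 1], rule exI[of _ "\<lambda>_. C"]) (use assms in \<open>auto simp: cs_deduction_def\<close>)

lemma cs_deducible_resolvent:
  assumes "cs_deducible S C" "cs_deducible S D" "x \<in> C" "complement x \<in> D"
  shows "cs_deducible S (C - {x} \<union> (D - {complement x}))"
proof -
  obtain t \<phi> where \<phi>: "cs_deduction S t \<phi>" "\<phi> t = C"
    using assms(1) unfolding cs_deducible_def by blast
  obtain u \<psi> where \<psi>: "cs_deduction S u \<psi>" "\<psi> u = D"
    using assms(2) unfolding cs_deducible_def by blast
  let ?\<chi> = "\<lambda>i. if i \<le> t then \<phi> i else \<psi> (i - t)"
  let ?r = "\<lambda>j::nat. if j = 1 then t else t + u"
  let ?R = "C - {x} \<union> (D - {complement x})"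
  \<comment> \<open>\<open>1 \<le> u\<close> puts index \<open>t + u\<close> into the second branch
    of \<open>?\<chi>\<close>, so that its value there is \<open>D\<close>.\<close>
  have pos: "1 \<le> t" "1 \<le> u" and fin: "is_clause C" "is_clause D"
    using \<phi> \<psi> unfolding cs_deduction_def by auto
  have res: "is_cs_clause 2 (\<lambda>j. ?\<chi> (?r j)) ?R"
    using is_cs_clause_resolvent[of "\<lambda>j. ?\<chi> (?r j)" x] pos fin assms(3,4) \<phi>(2) \<psi>(2) by simp
  have R: "is_clause ?R" using fin unfolding is_clause_def by simp
  have r: "\<forall>j\<in>{1..2}. ?r j \<in> {1..t + u}" using pos by auto
  have "cs_deduction S (Suc (t + u)) (?\<chi>(Suc (t + u) := ?R))"
    by (rule cs_deduction_snoc[OF cs_deduction_append[OF \<phi>(1) \<psi>(1)] R r res])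
  then show ?thesis
    unfolding cs_deducible_def by (meson fun_upd_same)
qed

lemma falsified_cs_deducible_clause:
  assumes "\<forall>C\<in>S. is_clause C" "\<not> satisfiable S" "finite B"
  shows "\<exists>C. cs_deducible S C \<and> C \<subseteq> \<Union>S \<and> \<not> clause_true v C \<and> (\<forall>q\<in>B. Pos q \<notin> C \<and> Neg q \<notin> C)"
  using \<open>finite B\<close>
\<comment> \<open>The valuation is generalised because the step uses the induction hypothesis at
  both updates of \<open>v\<close> at \<open>p\<close>.\<close>
proof (induction B arbitrary: v rule: finite_induct)
  case empty
  obtain C where "C \<in> S" "\<not> clause_true v C"
    using assms(2) unfolding satisfiable_def by blast
  then show ?case
    using cs_deducible_input assms(1) by blast
next
  case (insert p B)
  \<comment> \<open>A clause without \<open>p\<close> has the same truth value under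
    \<open>v\<close> and under any update of \<open>v\<close> at \<open>p\<close>.\<close>
  have free: "\<not> clause_true v C" if "\<not> clause_true (v(p := b)) C" "Pos p \<notin> C" "Neg p \<notin> C" for C b
  proof -
    have "literal_true (v(p := b)) l = literal_true v l" if "l \<in> C" for l
      using that \<open>Pos p \<notin> C\<close> \<open>Neg p \<notin> C\<close> by (cases l) auto
    with that(1) show ?thesis unfolding clause_true_def by blast
  qed
  obtain C where C: "cs_deducible S C" "C \<subseteq> \<Union>S" "\<not> clause_true (v(p := False)) C"
    "\<forall>q\<in>B. Pos q \<notin> C \<and> Neg q \<notin> C"
    using insert.IH by meson
  obtain D where D: "cs_deducible S D" "D \<subseteq> \<Union>S" "\<not> clause_true (v(p := True)) D"
    "\<forall>q\<in>B. Pos q \<notin> D \<and> Neg q \<notin> D"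
    using insert.IH by meson
  \<comment> \<open>\<open>Neg p\<close> is true when \<open>p\<close> is \<open>False\<close>, so
    the falsified \<open>C\<close> cannot contain it; dually for \<open>D\<close>.\<close>
  have nC: "Neg p \<notin> C" and nD: "Pos p \<notin> D"
    using C(3) D(3) unfolding clause_true_def by force+
  consider "Pos p \<notin> C" | "Neg p \<notin> D" | "Pos p \<in> C" "Neg p \<in> D" by blast
  then show ?case
  proof cases
    case 1
    with free[OF C(3)] nC C show ?thesis by blast
  next
    case 2
    with free[OF D(3)] nD D show ?thesis by blast
  next
    case 3
    let ?R = "C - {Pos p} \<union> (D - {Neg p})"
    have "cs_deducible S ?R"
      using cs_deducible_resolvent[OF C(1) D(1) 3(1)] 3(2) by simp
    \<comment> \<open>Each remainder is part of a falsified clause and no longer mentions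
      \<open>p\<close>, so \<open>free\<close> carries its falsity over to \<open>v\<close>.\<close>
    moreover have "\<not> clause_true v (C - {Pos p})" "\<not> clause_true v (D - {Neg p})"
      using C(3) D(3) nC nD free[of False "C - {Pos p}"] free[of True "D - {Neg p}"]
      unfolding clause_true_def by blast+
    then have "\<not> clause_true v ?R" unfolding clause_true_def by blast
    ultimately show ?thesis
      using C(2,4) D(2,4) nC nD by (intro exI[of _ ?R]) auto
  qed
qed

theorem theorem4p3:
  fixes S :: "'a clause set"
  assumes "finite S"
    and "\<forall>C\<in>S. is_clause C"
    and "\<forall>C\<in>S. \<not> tautology C"
    and "\<forall>C\<in>S. \<not> pure_literal_clause S C"
    and "\<not> satisfiable S"
  shows "\<exists>t \<phi>. cs_deduction S t \<phi> \<and> \<phi> t = {}"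
proof -
  \<comment> \<open>\<open>set_literal\<close> is the set function of the datatype, so
    \<open>?V\<close> collects the variables occurring in \<open>S\<close>.\<close>
  let ?V = "\<Union>l\<in>\<Union>S. set_literal l"
  have "finite (set_literal l)" for l :: "'a literal"
    by (cases l) auto
  then have "finite ?V"
    using assms(1,2) unfolding is_clause_def by blast
  then obtain C where C: "cs_deducible S C" "C \<subseteq> \<Union>S" "\<forall>q\<in>?V. Pos q \<notin> C \<and> Neg q \<notin> C"
    using falsified_cs_deducible_clause[OF assms(2,5)] by meson
  \<comment> \<open>By \<open>C \<subseteq> \<Union>S\<close> the variable of any literal of
    \<open>C\<close> would lie in \<open>?V\<close>, which \<open>C\<close> avoids.\<close>
  have "l \<notin> C" for l
  proof
    assume l: "l \<in> C"
    then have "set_literal l \<subseteq> ?V" using C(2) by blast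
    with l C(3) show False by (cases l) auto
  qed
  then have "C = {}" by blast
  with C(1) show ?thesis unfolding cs_deducible_def by blast
qed

end
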